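(* Let $n\ge 1$. An $n$-tuple $X=(x_1,\dots,x_n)$ satisfies the Loosened Collatz Function (LCF) if and only if all bitwise rotations of $X$ (the tuples $R^k(X)$, $k\in\mathbb{N}_1$) satisfy the LCF.
   Context: $\mathbb{N}_0$ denotes the non-negative integers and $\mathbb{N}_1$ the positive integers. For an $n$-tuple $Y=(y_1,\dots,y_n)$ of non-negative integers, the Loosened Collatz Function (LCF) is $$F_L(Y)=\frac{\sum_{i=1}^{n}3^{n-i}\cdot 2^{\sum_{j=0}^{i-1}y_j}}{2^{\sum_{i=1}^{n}y_i}-3^n},\qquad y_0=0,$$ where $y_0=0$ is a convention and not an entry of the tuple. A tuple satisfies the LCF if each of its entries is a non-negative integer and $F_L$ of the tuple is a positive integer. The left bitwise rotation $R:\mathbb{N}_0^n\to\mathbb{N}_0^n$ is $R(a_1,a_2,\dots,a_{n-1},a_n)=(a_2,a_3,\dots,a_n,a_1)$. *)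

theory Defs
  imports Complex_Main
begin

text \<open>
  An \<open>n\<close>-tuple \<open>(y\<^sub>1, \<dots>, y\<^sub>n)\<close> of non-negative integers is a \<open>nat list\<close> of length \<open>n\<close>.
  The list \<open>0 # Y\<close> realises the convention \<open>y\<^sub>0 = 0\<close>: \<open>(0 # Y) ! j\<close> is \<open>y\<^sub>j\<close> for
  \<open>0 \<le> j \<le> n\<close>. The denominator is nonzero whenever \<open>Y\<close> is nonempty.
\<close>

definition F_L :: "nat list \<Rightarrow> rat" where
  "F_L Y = (let n = length Y; y = (\<lambda>j. (0 # Y) ! j) in
     (\<Sum>i = 1..n. 3 ^ (n - i) * 2 ^ (\<Sum>j = 0..i - 1. y j)) /
     (2 ^ (\<Sum>i = 1..n. y i) - 3 ^ n))"

text \<open>Entries are non-negative integers by typing.\<close>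

definition satisfies_LCF :: "nat list \<Rightarrow> bool" where
  "satisfies_LCF Y \<longleftrightarrow> F_L Y \<in> \<int> \<and> F_L Y > 0"

end

theory Submission
  imports Defs
begin

text \<open>
  Write \<open>F_L Y = N / D\<close> with \<open>D = 2 ^ S - 3 ^ n\<close>, where \<open>S\<close> is the sum of the entries of \<open>Y\<close>.
  A rotation leaves \<open>D\<close> unchanged, and moving the first entry \<open>a\<close> to the end turns the numerator
  \<open>N\<close> into some \<open>N'\<close> with \<open>2 ^ a * N' = 3 * N + D\<close>; thus \<open>F_L\<close> of the rotated tuple is the
  (generalised) Collatz step \<open>(3 * F_L Y + 1) / 2 ^ a\<close>. Positivity is inherited at once. For
  integrality, \<open>D dvd N\<close> gives \<open>D dvd 2 ^ a * N'\<close>, and the power of two can be cancelled: either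
  \<open>a = 0\<close>, or \<open>S > 0\<close> and then \<open>D\<close> is odd. Hence the LCF passes from a tuple to its rotation, and
  by iteration to all rotations. Conversely, \<open>X\<close> is its own \<open>n\<close>-th rotation.
\<close>

text \<open>
  The recursion peels off the first entry, which contributes the factor \<open>2 ^ a\<close> to every term
  of the numerator of \<open>F_L\<close> except the first one.
\<close>

fun LCF_numerator :: "nat list \<Rightarrow> int" where
  "LCF_numerator [] = 0"
| "LCF_numerator (a # Y) = 3 ^ length Y + 2 ^ a * LCF_numerator Y"

definition LCF_denominator :: "nat list \<Rightarrow> int" where
  "LCF_denominator Y = 2 ^ sum_list Y - 3 ^ length Y"

lemma LCF_numerator_eq_sum:
  "LCF_numerator Y = (\<Sum>i<length Y. 3 ^ (length Y - Suc i) * 2 ^ sum_list (take i Y))"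
proof (induction Y)
  case (Cons a Y)
  show ?case
    by (simp add: Cons.IH sum.lessThan_Suc_shift sum_distrib_left power_add mult_ac
             del: sum.lessThan_Suc)
qed simp

lemma F_L_eq_quotient:
  "F_L Y = of_int (LCF_numerator Y) / of_int (LCF_denominator Y)"
proof -
  have exponent: "(\<Sum>j = 0..i. (0 # Y) ! j) = sum_list (take i Y)" if "i < length Y" for i
    using that
    by (simp add: sum_list_sum_nth atLeast0AtMost sum.atMost_shift atLeast0LessThan min_def)
  have "(\<Sum>i = 1..length Y. 3 ^ (length Y - i) * 2 ^ (\<Sum>j = 0..i - 1. (0 # Y) ! j))
      = (\<Sum>i<length Y. 3 ^ (length Y - Suc i) * 2 ^ (\<Sum>j = 0..i. (0 # Y) ! j) :: rat)"
    by (simp add: sum.atLeast1_atMost_eq)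
  also have "\<dots> = of_int (LCF_numerator Y)"
    by (simp add: LCF_numerator_eq_sum exponent)
  finally have numerator:
    "(\<Sum>i = 1..length Y. 3 ^ (length Y - i) * 2 ^ (\<Sum>j = 0..i - 1. (0 # Y) ! j))
      = (of_int (LCF_numerator Y) :: rat)" .
  have "(\<Sum>i = 1..length Y. (0 # Y) ! i) = sum_list Y"
    by (simp add: sum.atLeast1_atMost_eq sum_list_sum_nth atLeast0LessThan)
  with numerator show ?thesis
    by (simp add: F_L_def Let_def LCF_denominator_def)
qed

lemma odd_LCF_denominator: "odd (LCF_denominator Y)" if "sum_list Y > 0"
  using that by (simp add: LCF_denominator_def)

text \<open>
  If some entry is positive, the denominator is odd; otherwise it is \<open>1 - 3 ^ n\<close>.
\<close>

lemma LCF_denominator_nonzero: "LCF_denominator Y \<noteq> 0" if "Y \<noteq> []"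
proof (cases "sum_list Y > 0")
  case True
  then have "odd (LCF_denominator Y)" by (rule odd_LCF_denominator)
  then show ?thesis by auto
next
  case False
  then have "LCF_denominator Y = 1 - 3 ^ length Y"
    by (simp only: LCF_denominator_def not_gr_zero power_0)
  moreover have "(1::int) < 3 ^ length Y"
    using that by (intro one_less_power) auto
  ultimately show ?thesis by simp
qed

lemma LCF_denominator_rotate1: "LCF_denominator (rotate1 Y) = LCF_denominator Y"
  by (cases Y) (simp_all add: LCF_denominator_def add.commute)

lemma LCF_numerator_snoc:
  "LCF_numerator (Y @ [a]) = 3 * LCF_numerator Y + 2 ^ sum_list Y"
  by (induction Y) (simp_all add: algebra_simps power_add)

text \<open>
  With \<open>M\<close> the numerator of \<open>Y\<close>, the numerators before and after the rotation are
  \<open>3 ^ length Y + 2 ^ a * M\<close> and \<open>3 * M + 2 ^ sum_list Y\<close>; eliminating \<open>M\<close> leaves exactly the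
  denominator.
\<close>

lemma LCF_numerator_rotate1:
  "2 ^ a * LCF_numerator (rotate1 (a # Y)) =
     3 * LCF_numerator (a # Y) + LCF_denominator (a # Y)"
  by (simp add: LCF_numerator_snoc LCF_denominator_def algebra_simps power_add)

lemma F_L_rotate1: "F_L (rotate1 (a # Y)) = (3 * F_L (a # Y) + 1) / 2 ^ a"
proof -
  let ?D = "of_int (LCF_denominator (a # Y)) :: rat"
  have D: "?D \<noteq> 0"
    using LCF_denominator_nonzero[of "a # Y"] by simp
  let ?N = "of_int (LCF_numerator (a # Y)) :: rat"
  let ?N' = "of_int (LCF_numerator (rotate1 (a # Y))) :: rat"
  have N': "2 ^ a * ?N' = 3 * ?N + ?D"
    using arg_cong[OF LCF_numerator_rotate1[of a Y], of "of_int :: int \<Rightarrow> rat"]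
    by (simp only: of_int_mult of_int_add of_int_power of_int_numeral)
  have "?N' / ?D = (2 ^ a * ?N') / ?D / 2 ^ a"
    by simp
  also have "\<dots> = (3 * (?N / ?D) + 1) / 2 ^ a"
    unfolding N' using D by (simp add: add_divide_distrib del: LCF_numerator.simps)
  finally show ?thesis
    by (simp only: F_L_eq_quotient LCF_denominator_rotate1)
qed

lemma F_L_in_Ints_iff:
  assumes "Y \<noteq> []"
  shows "F_L Y \<in> \<int> \<longleftrightarrow> LCF_denominator Y dvd LCF_numerator Y"
  using LCF_denominator_nonzero[OF assms]
  by (simp add: F_L_eq_quotient of_int_div_of_int_in_Ints_iff)

lemma satisfies_LCF_rotate1:
  assumes "satisfies_LCF Y"
  shows "satisfies_LCF (rotate1 Y)"
proof (cases Y)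
  case Nil
  then show ?thesis using assms by simp
next
  case (Cons a Z)
  let ?D = "LCF_denominator Y" and ?N' = "LCF_numerator (rotate1 Y)"
  have "F_L (rotate1 Y) > 0"
    using assms unfolding satisfies_LCF_def Cons F_L_rotate1
    by (intro divide_pos_pos add_pos_pos mult_pos_pos) auto
  moreover have "F_L (rotate1 Y) \<in> \<int>"
  proof -
    have "?D dvd LCF_numerator Y"
      using assms F_L_in_Ints_iff[of Y] Cons by (simp only: satisfies_LCF_def list.distinct not_False_eq_True)
    then have "?D dvd 2 ^ a * ?N'"
      unfolding Cons LCF_numerator_rotate1 by (intro dvd_add dvd_mult dvd_refl)
    moreover have "coprime ?D (2 ^ a)"
    proof (cases "a = 0")
      case False
      then show ?thesis
        using odd_LCF_denominator[of Y] Cons by simp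
    qed simp
    ultimately have "?D dvd ?N'"
      by (simp only: coprime_dvd_mult_right_iff)
    moreover have "rotate1 Y \<noteq> []"
      by (simp add: Cons)
    ultimately show ?thesis
      by (simp add: F_L_in_Ints_iff LCF_denominator_rotate1)
  qed
  ultimately show ?thesis by (simp add: satisfies_LCF_def)
qed

theorem theorem2:
  fixes n :: nat and X :: "nat list"
  assumes "n \<ge> 1" and "length X = n"
  shows "satisfies_LCF X \<longleftrightarrow> (\<forall>k\<ge>1. satisfies_LCF ((rotate1 ^^ k) X))"
proof
  assume "satisfies_LCF X"
  then have "satisfies_LCF ((rotate1 ^^ k) X)" for k
    by (induction k) (simp_all add: satisfies_LCF_rotate1)
  then show "\<forall>k\<ge>1. satisfies_LCF ((rotate1 ^^ k) X)" by blast
next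
  assume "\<forall>k\<ge>1. satisfies_LCF ((rotate1 ^^ k) X)"
  then have "satisfies_LCF ((rotate1 ^^ n) X)"
    using assms(1) by blast
  moreover have "(rotate1 ^^ n) X = X"
    using rotate_id[of n X] assms(2) by (simp add: rotate_def)
  ultimately show "satisfies_LCF X" by simp
qed

end
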